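(* For each $n \geq 2$ let $$\Phi(n)=\frac{|\{k : \text{the } S_k\text{-length of } \text{Möb}^{+}(n) \text{ is } 2\}|}{|\{\text{conjugacy classes of involutions in } \text{Möb}(n)\}|},$$ where $k$ ranges over $\{1,\dots,n\}$. Then $\Phi(n)=O(n^{-1/2})$ as $n\to\infty$.
   Context: $\mathbb{H}^n$ is hyperbolic $n$-space, $\text{Möb}(n)$ is its full isometry group, and $\text{Möb}^{+}(n)$ is the subgroup of orientation preserving isometries. An involution is an isometry of $\mathbb{H}^n$ of order two; its fixed point set is a totally geodesic subspace. A $k$-involution is an involution whose fixed point set has codimension $k$, and $S_k \subset \text{Möb}(n)$ is the set of all $k$-involutions, $k=1,\dots,n$. The conjugacy class of an involution is determined by the dimension of its fixed point set, so the conjugacy classes of involutions are exactly $S_1,\dots,S_n$ and the denominator of $\Phi(n)$ equals $n$. For a group $G$ and a symmetric set $S$ of generators of a group containing $G$, the $S$-length of $g\in G$ is the minimal number of elements of $S$ needed to express $g$ as their product, and the $S$-length of $G$ is the supremum of the $S$-lengths of all $g\in G$. *)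

theory Defs
  imports
    "Jordan_Normal_Form.Determinant"
    "Jordan_Normal_Form.VS_Connect"
    "HOL-Algebra.Bij"
    "HOL-Algebra.Multiplicative_Group"
    "HOL-Library.Extended_Nat"
    "HOL-Library.Landau_Symbols"
begin

text \<open>Hyperbolic \<open>n\<close>-space is the upper sheet of the hyperboloid \<open>\<langle>x, x\<rangle> = -1\<close> in
  Minkowski space, i.e. in real vectors of dimension \<open>n + 1\<close> with time coordinate \<open>x $ 0\<close>.\<close>

definition minkowski :: "real vec \<Rightarrow> real vec \<Rightarrow> real" where
  "minkowski x y = (\<Sum>i = 1..<dim_vec x. x $ i * y $ i) - x $ 0 * y $ 0"

definition hyperbolic_space :: "nat \<Rightarrow> real vec set" where
  "hyperbolic_space n = {x \<in> carrier_vec (Suc n). minkowski x x = - 1 \<and> x $ 0 > 0}"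

definition hyperbolic_dist :: "real vec \<Rightarrow> real vec \<Rightarrow> real" where
  "hyperbolic_dist x y = arcosh (- minkowski x y)"

definition isometries :: "nat \<Rightarrow> (real vec \<Rightarrow> real vec) set" where
  "isometries n = {f \<in> Bij (hyperbolic_space n).
     \<forall>x \<in> hyperbolic_space n. \<forall>y \<in> hyperbolic_space n.
       hyperbolic_dist (f x) (f y) = hyperbolic_dist x y}"

definition Mob :: "nat \<Rightarrow> (real vec \<Rightarrow> real vec) monoid" where
  "Mob n = BijGroup (hyperbolic_space n) \<lparr>carrier := isometries n\<rparr>"

lemma subgroup_isometries: "subgroup (isometries n) (BijGroup (hyperbolic_space n))"
proof (rule subgroup.intro)
  show "isometries n \<subseteq> carrier (BijGroup (hyperbolic_space n))"
    by (auto simp: isometries_def BijGroup_def)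
next
  fix f g assume "f \<in> isometries n" "g \<in> isometries n"
  then show "f \<otimes>\<^bsub>BijGroup (hyperbolic_space n)\<^esub> g \<in> isometries n"
    by (auto simp: isometries_def BijGroup_def compose_Bij compose_eq Pi_iff
        dest!: Bij_imp_funcset)
next
  show "\<one>\<^bsub>BijGroup (hyperbolic_space n)\<^esub> \<in> isometries n"
    by (simp add: isometries_def BijGroup_def id_Bij)
next
  fix f assume f: "f \<in> isometries n"
  let ?H = "hyperbolic_space n"
  have B: "f \<in> Bij ?H" and D: "\<And>x y. x \<in> ?H \<Longrightarrow> y \<in> ?H \<Longrightarrow>
      hyperbolic_dist (f x) (f y) = hyperbolic_dist x y"
    using f by (auto simp: isometries_def)
  have "f (inv_into ?H f x) = x" if "x \<in> ?H" for x
    using B that by (simp add: Bij_def bij_betw_def f_inv_into_f)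
  then have "hyperbolic_dist (inv_into ?H f x) (inv_into ?H f y) = hyperbolic_dist x y"
    if "x \<in> ?H" "y \<in> ?H" for x y
    using that D[of "inv_into ?H f x" "inv_into ?H f y"] Bij_inv_into_mem[OF B] by simp
  then show "inv\<^bsub>BijGroup ?H\<^esub> f \<in> isometries n"
    using B by (simp add: isometries_def inv_BijGroup restrict_inv_into_Bij)
qed

lemma group_Mob: "group (Mob n)"
  unfolding Mob_def
  by (rule group.subgroup_imp_group[OF group_BijGroup subgroup_isometries])

text \<open>For \<open>n \<ge> 1\<close> the matrix \<open>A\<close> below is unique, because hyperbolic space spans Minkowski
  space. It maps \<open>x\<close> to \<open>f x\<close> and the tangent space at \<open>x\<close> (the Minkowski-orthogonal complement
  of \<open>x\<close>) to the one at \<open>f x\<close> by the differential of \<open>f\<close>. Orient hyperbolic space by calling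
  a tangent basis \<open>v\<^sub>1, \<dots>, v\<^sub>n\<close> at \<open>x\<close> positive if \<open>x, v\<^sub>1, \<dots>, v\<^sub>n\<close> is a positive basis of the
  ambient space; then the differential preserves orientation iff \<open>det A > 0\<close>.\<close>

definition Mob_plus :: "nat \<Rightarrow> (real vec \<Rightarrow> real vec) set" where
  "Mob_plus n = {f \<in> carrier (Mob n).
     \<exists>A \<in> carrier_mat (Suc n) (Suc n).
       (\<forall>x \<in> hyperbolic_space n. f x = A *\<^sub>v x) \<and> det A > 0}"

text \<open>The totally geodesic subspaces of dimension \<open>m\<close> are the nonempty intersections of the
  hyperboloid with linear subspaces of dimension \<open>m + 1\<close>.\<close>

definition totally_geodesic :: "nat \<Rightarrow> nat \<Rightarrow> real vec set \<Rightarrow> bool" where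
  "totally_geodesic n m F \<longleftrightarrow> F \<noteq> {} \<and>
     (\<exists>W. VectorSpace.subspace class_ring W (module_vec TYPE(real) (Suc n)) \<and>
          vectorspace.dim class_ring (module_vec TYPE(real) (Suc n) \<lparr>carrier := W\<rparr>) = Suc m \<and>
          F = hyperbolic_space n \<inter> W)"

definition involutions :: "('a, 'b) monoid_scheme \<Rightarrow> 'a set" where
  "involutions G = {g \<in> carrier G. group.ord G g = 2}"

definition k_involutions :: "nat \<Rightarrow> nat \<Rightarrow> (real vec \<Rightarrow> real vec) set" where
  "k_involutions n k = {f \<in> involutions (Mob n).
     \<exists>m. m + k = n \<and> totally_geodesic n m {x \<in> hyperbolic_space n. f x = x}}"

definition conjugacy_class :: "('a, 'b) monoid_scheme \<Rightarrow> 'a \<Rightarrow> 'a set" where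
  "conjugacy_class G x = {g \<otimes>\<^bsub>G\<^esub> x \<otimes>\<^bsub>G\<^esub> inv\<^bsub>G\<^esub> g | g. g \<in> carrier G}"

text \<open>Elements that are not products of elements of \<open>S\<close> have length \<open>\<infinity>\<close>; the empty product is
  the identity.\<close>

definition word_length :: "('a, 'b) monoid_scheme \<Rightarrow> 'a set \<Rightarrow> 'a \<Rightarrow> enat" where
  "word_length G S g =
     (INF ws \<in> {ws \<in> lists S. foldr (mult G) ws \<one>\<^bsub>G\<^esub> = g}. enat (length ws))"

definition length_wrt :: "('a, 'b) monoid_scheme \<Rightarrow> 'a set \<Rightarrow> 'a set \<Rightarrow> enat" where
  "length_wrt G S A = (SUP g \<in> A. word_length G S g)"

definition Phi :: "nat \<Rightarrow> real" where
  "Phi n =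
     real (card {k \<in> {1..n}. length_wrt (Mob n) (k_involutions n k) (Mob_plus n) = 2}) /
     real (card (conjugacy_class (Mob n) ` involutions (Mob n)))"

end

theory Submission
  imports Defs "Jordan_Normal_Form.DL_Rank" "Jordan_Normal_Form.Matrix_Kernel"
begin

text \<open>
  An isometry of hyperbolic space is the restriction of a unique linear map of Minkowski space
  \<open>\<real>\<^bsup>n+1\<^esup>\<close> (\<open>isometry_represented\<close>), so lengths can be studied by linear algebra. The relevant
  invariant of a linear map \<open>A\<close> is the rank of \<open>A - 1\<close>, called its residual rank: it is the
  codimension of the fixed space, and for a \<open>k\<close>-involution it equals \<open>k\<close>
  (\<open>k_involution_residual_rank\<close>).

  If \<open>A\<close> and \<open>B\<close> are involutions of residual rank \<open>k\<close>, then the fixed space of \<open>A B\<close> contains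
  both the intersection of the two fixed spaces, which have dimension \<open>n + 1 - k\<close>, and the
  intersection of the two \<open>(-1)\<close>-eigenspaces, which have dimension \<open>k\<close>. Hence the residual rank
  of \<open>A B\<close> is at most \<open>2 k\<close> and at most \<open>2 (n + 1 - k)\<close>. Now take for the product an isometry that
  moves almost everything: the diagonal map with sign \<open>-1\<close> in all spatial coordinates, or in all
  but one of them, whichever makes the determinant positive. Its residual rank is \<open>n\<close> or \<open>n - 1\<close>,
  so if it is a product of two \<open>k\<close>-involutions then \<open>n - 1 \<le> 2 k \<le> n + 3\<close>; if it is itself a
  \<open>k\<close>-involution then \<open>k\<close> is \<open>n - 1\<close> or \<open>n\<close>. This leaves at most five values of \<open>k\<close>
  (\<open>codimension_of_length_two\<close>).

  The residual rank is invariant under conjugation and takes every value \<open>1, \<dots>, n\<close> on diagonal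
  involutions, so there are at least \<open>n\<close> conjugacy classes (\<open>card_conjugacy_classes_ge\<close>).
  Therefore \<open>Phi n \<le> 5 / n\<close>, which is stronger than the bound of order \<open>n\<^bsup>-1/2\<^esup>\<close>.
\<close>

section \<open>Rank and kernel of a matrix\<close>

lemma mat_kernel_fin_dim:
  fixes A :: "'a :: field mat"
  assumes A: "A \<in> carrier_mat nr nc"
  shows "vectorspace.fin_dim class_ring (module_vec TYPE('a) nc\<lparr>carrier := mat_kernel A\<rparr>)"
proof -
  interpret kernel nr nc A by (unfold_locales, rule A)
  obtain B where "finite B" "basis B"
    using kernel_basis_exists[OF A] by blast
  then show ?thesis
    unfolding Ker.fin_dim_def Ker.basis_def by auto
qed

context vec_space
begin

text \<open>Rank-nullity for \<open>x \<mapsto> A x\<close>, whose image is the column space.\<close>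

lemma rank_plus_dim_kernel:
  assumes A: "A \<in> carrier_mat n nc"
  shows "rank A + vectorspace.dim class_ring (module_vec TYPE('a) nc\<lparr>carrier := mat_kernel A\<rparr>) = nc"
proof -
  interpret dom: vec_space "TYPE('a)" nc .
  have hom: "(\<lambda>x. A *\<^sub>v x) \<in> LinearCombinations.module_hom class_ring dom.V V"
    using A by (auto simp: LinearCombinations.module_hom_def class_ring_simps module_vec_simps
        mult_add_distrib_mat_vec mult_mat_vec)
  interpret T: linear_map "class_ring :: 'a ring" dom.V V "\<lambda>x. A *\<^sub>v x"
    by (intro linear_map.intro mod_hom.intro mod_hom_axioms.intro hom) unfold_locales
  have "T.imT = col_space A"
    unfolding T.im_def col_space_eq[OF A] using A by (auto simp: module_vec_simps)
  moreover have "T.kerT = mat_kernel A"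
    unfolding T.ker_def mat_kernel_def using A by (auto simp: module_vec_simps)
  ultimately show ?thesis
    using T.rank_nullity[OF dom.fin_dim] unfolding rank_def col_space_def dom.dim_is_n by simp
qed

lemma dim_mono:
  assumes X: "VectorSpace.subspace class_ring X V" "vectorspace.fin_dim class_ring (vs X)"
    and W: "VectorSpace.subspace class_ring W V" "vectorspace.fin_dim class_ring (vs W)"
    and "X \<subseteq> W"
  shows "vectorspace.dim class_ring (vs X) \<le> vectorspace.dim class_ring (vs W)"
proof -
  have "vectorspace class_ring (vs W)" by (rule subspace_is_vs[OF W(1)])
  from vectorspace.subspace_dim[OF this nested_subspaces[OF W(1) X(1) \<open>X \<subseteq> W\<close>] W(2)]
  show ?thesis using X(2) by simp
qed

lemma col_space_subspace_fin_dim: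
  assumes A: "A \<in> carrier_mat n nc"
  shows "VectorSpace.subspace class_ring (col_space A) V" "vectorspace.fin_dim class_ring (vs (col_space A))"
  using span_is_subspace[of "set (cols A)"] fin_dim_span_cols[OF A] cols_dim[of A] A
  unfolding col_space_def by auto

lemma rank_mult_le_left:
  assumes A: "A \<in> carrier_mat n nc" and B: "B \<in> carrier_mat nc m"
  shows "rank (A * B) \<le> rank A"
proof -
  have "A *\<^sub>v (B *\<^sub>v x) \<in> col_space A" if "x \<in> carrier_vec m" for x
    unfolding col_space_eq[OF A] using A B that by auto
  then have "col_space (A * B) \<subseteq> col_space A"
    using A B by (auto simp: col_space_eq[of "A * B" m])
  then show ?thesis
    unfolding rank_def col_space_def[symmetric]
    using A B by (intro dim_mono col_space_subspace_fin_dim) auto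
qed

lemma mat_kernel_subspace:
  assumes A: "A \<in> carrier_mat nr n"
  shows "VectorSpace.subspace class_ring (mat_kernel A) V"
proof -
  have "submodule class_ring (mat_kernel A) V"
    using A by (intro submodule.intro)
      (auto simp: mat_kernel_def module_axioms mult_add_distrib_mat_vec mult_mat_vec class_ring_simps)
  then show ?thesis unfolding VectorSpace.subspace_def using vectorspace_axioms by auto
qed

lemma rank_uminus_le:
  assumes A: "A \<in> carrier_mat n nc"
  shows "rank (- A) \<le> rank A"
proof -
  have "- A = A * (- 1\<^sub>m nc)" using A by simp
  then show ?thesis using rank_mult_le_left[OF A, of "- 1\<^sub>m nc" nc] by simp
qed

lemma rank_mult_left_invertible:
  assumes A: "A \<in> carrier_mat n nc" and U: "U \<in> carrier_mat n n" "U' \<in> carrier_mat n n" "U' * U = 1\<^sub>m n"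
  shows "rank (U * A) = rank A"
proof -
  have "mat_kernel (U * A) = mat_kernel A"
    by (rule mat_kernel_mult_eq[OF A U])
  then show ?thesis
    using rank_plus_dim_kernel[OF A] rank_plus_dim_kernel[of "U * A" nc] U(1) A by simp
qed

text \<open>The range of \<open>B\<close> lies in the kernel of \<open>A\<close>.\<close>

lemma rank_add_rank_le_if_mult_eq_0:
  assumes A: "A \<in> carrier_mat n n" and B: "B \<in> carrier_mat n n" and AB: "A * B = 0\<^sub>m n n"
  shows "rank A + rank B \<le> n"
proof -
  have "A *\<^sub>v (B *\<^sub>v x) = 0\<^sub>v n" if "x \<in> carrier_vec n" for x
    using assoc_mult_mat_vec[OF A B that] AB that by (auto simp: vec_eq_iff)
  then have "col_space B \<subseteq> mat_kernel A"
    using A B by (auto simp: col_space_eq[OF B] mat_kernel_def)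
  then have "rank B \<le> vectorspace.dim class_ring (vs (mat_kernel A))"
    unfolding rank_def col_space_def[symmetric]
    using dim_mono col_space_subspace_fin_dim[OF B] mat_kernel_subspace[OF A] mat_kernel_fin_dim[OF A]
    by blast
  then show ?thesis
    using rank_plus_dim_kernel[OF A] by simp
qed

end

text \<open>The codimension of the fixed space of \<open>A\<close>. The rank of \<open>A - 1\<close> is preferred to the dimension
  of a kernel because rank is subadditive.\<close>

definition residual_rank :: "nat \<Rightarrow> 'a :: field mat \<Rightarrow> nat" where
  "residual_rank n A = vec_space.rank n (A - 1\<^sub>m n)"

text \<open>A product fixes every vector fixed by both factors; in terms of ranks,
  \<open>A B - 1 = (A - 1) B + (B - 1)\<close>.\<close>

lemma residual_rank_mult_le:
  fixes A B :: "'a :: field mat"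
  assumes A: "A \<in> carrier_mat n n" and B: "B \<in> carrier_mat n n"
  shows "residual_rank n (A * B) \<le> residual_rank n A + residual_rank n B"
proof -
  have eq: "A * B - 1\<^sub>m n = (A - 1\<^sub>m n) * B + (B - 1\<^sub>m n)"
    using A B by (auto simp: minus_mult_distrib_mat[of _ n n])
  have "residual_rank n (A * B) \<le> vec_space.rank n ((A - 1\<^sub>m n) * B) + residual_rank n B"
    unfolding residual_rank_def eq
    using A B by (intro vec_space.rank_subadditive[of _ n n] mult_carrier_mat[of _ n n]) auto
  moreover have "vec_space.rank n ((A - 1\<^sub>m n) * B) \<le> residual_rank n A"
    unfolding residual_rank_def using A B by (intro vec_space.rank_mult_le_left) auto
  ultimately show ?thesis by simp
qed

text \<open>The product \<open>(A + 1) (A - 1) = A\<^sup>2 - 1\<close> vanishes. The rank of \<open>A + 1\<close> is the codimension of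
  the \<open>(-1)\<close>-eigenspace.\<close>

lemma rank_involution_plus_one:
  fixes A :: "'a :: field mat"
  assumes A: "A \<in> carrier_mat n n" and AA: "A * A = 1\<^sub>m n"
  shows "vec_space.rank n (A + 1\<^sub>m n) + residual_rank n A \<le> n"
proof -
  have "(A + 1\<^sub>m n) * (A - 1\<^sub>m n) = A * (A - 1\<^sub>m n) + 1\<^sub>m n * (A - 1\<^sub>m n)"
    using A by (intro add_mult_distrib_mat) auto
  also have "\<dots> = 0\<^sub>m n n"
    using A AA by (subst mult_minus_distrib_mat[of _ n n]) (auto)
  finally show ?thesis
    unfolding residual_rank_def
    using A by (intro vec_space.rank_add_rank_le_if_mult_eq_0) auto
qed

text \<open>A product fixes every common \<open>(-1)\<close>-eigenvector of its factors; in terms of ranks,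
  \<open>A B - 1 = (A + 1) B - (B + 1)\<close>.\<close>

lemma residual_rank_mult_involutions_le:
  fixes A B :: "'a :: field mat"
  assumes A: "A \<in> carrier_mat n n" "A * A = 1\<^sub>m n" and B: "B \<in> carrier_mat n n" "B * B = 1\<^sub>m n"
  shows "residual_rank n (A * B) + residual_rank n A + residual_rank n B \<le> 2 * n"
proof -
  have eq: "A * B - 1\<^sub>m n = (A + 1\<^sub>m n) * B + - (B + 1\<^sub>m n)"
    using A B by (auto simp: add_mult_distrib_mat[of _ n n])
  have "residual_rank n (A * B)
      \<le> vec_space.rank n ((A + 1\<^sub>m n) * B) + vec_space.rank n (- (B + 1\<^sub>m n))"
    unfolding residual_rank_def eq
    using A B by (intro vec_space.rank_subadditive[of _ n n] mult_carrier_mat[of _ n n]) auto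
  also have "\<dots> \<le> vec_space.rank n (A + 1\<^sub>m n) + vec_space.rank n (B + 1\<^sub>m n)"
    using A B by (intro add_mono vec_space.rank_mult_le_left vec_space.rank_uminus_le) auto
  finally show ?thesis
    using rank_involution_plus_one[OF A] rank_involution_plus_one[OF B] by simp
qed

text \<open>Intertwining \<open>A\<close> and \<open>B\<close> intertwines \<open>A - 1\<close> and \<open>B - 1\<close>. Applied in both directions, this
  shows that the residual rank is a conjugacy invariant.\<close>

lemma residual_rank_conjugate_le:
  fixes A B :: "'a :: field mat"
  assumes A: "A \<in> carrier_mat n n" and B: "B \<in> carrier_mat n n"
    and U: "U \<in> carrier_mat n n" "U' \<in> carrier_mat n n" "U' * U = 1\<^sub>m n"
    and eq: "A * U = U * B"
  shows "residual_rank n B \<le> residual_rank n A"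
proof -
  have "(A - 1\<^sub>m n) * U = U * (B - 1\<^sub>m n)"
    using A B U eq by (simp add: minus_mult_distrib_mat[of _ n n] mult_minus_distrib_mat[of _ n n])
  then have "residual_rank n B = vec_space.rank n ((A - 1\<^sub>m n) * U)"
    unfolding residual_rank_def using B U
    by (simp add: vec_space.rank_mult_left_invertible[of _ n n U U'] minus_carrier_mat)
  also have "\<dots> \<le> residual_rank n A"
    unfolding residual_rank_def using A U by (intro vec_space.rank_mult_le_left) auto
  finally show ?thesis .
qed

lemma residual_rank_one: "residual_rank n (1\<^sub>m n :: 'a :: field mat) = 0"
proof -
  have "1\<^sub>m n - 1\<^sub>m n = (0\<^sub>m n n :: 'a mat)" by auto
  then show ?thesis
    unfolding residual_rank_def by (simp only: vec_space.rank_0I)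
qed

definition flip_mat :: "nat \<Rightarrow> nat set \<Rightarrow> real mat" where
  "flip_mat n S = mat n n (\<lambda>(i, j). if i = j then if i \<in> S then - 1 else 1 else 0)"

lemma flip_mat_carrier [simp]: "flip_mat n S \<in> carrier_mat n n"
  by (simp add: flip_mat_def)

text \<open>Every additional sign changes the matrix by one of rank one.\<close>

lemma residual_rank_flip_mat_le:
  "finite S \<Longrightarrow> residual_rank n (flip_mat n S) \<le> card S"
proof (induction S rule: finite_induct)
  case empty
  have "flip_mat n {} = 1\<^sub>m n"
    by (auto simp: flip_mat_def)
  then show ?case
    by (simp add: residual_rank_one)
next
  case (insert s S)
  define E where "E = mat n n (\<lambda>(i, j). (if i = s then - 2 else 0) * (if j = s then 1 else 0 :: real))"
  have "flip_mat n (insert s S) - 1\<^sub>m n = (flip_mat n S - 1\<^sub>m n) + E"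
    using insert.hyps by (auto simp: flip_mat_def E_def)
  then have "residual_rank n (flip_mat n (insert s S)) \<le> residual_rank n (flip_mat n S) + vec_space.rank n E"
    unfolding residual_rank_def by (simp add: vec_space.rank_subadditive[of _ n n] minus_carrier_mat E_def)
  moreover have "vec_space.rank n E \<le> 1"
    by (rule vec_space.rank_le_1_product_entries[of _ n n]) (auto simp: E_def)
  ultimately show ?case
    using insert by simp
qed

text \<open>The upper bound for \<open>S\<close> and for its complement is an equality in both cases: the two
  cardinalities add up to \<open>n\<close>, and the two differences from the identity add up to the invertible
  matrix \<open>-2\<close>.\<close>

lemma residual_rank_flip_mat:
  assumes S: "S \<subseteq> {..<n}"
  shows "residual_rank n (flip_mat n S) = card S"
proof -
  have fin: "finite S" using S finite_subset by blast
  let ?T = "{..<n} - S"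
  have "(flip_mat n S - 1\<^sub>m n) + (flip_mat n ?T - 1\<^sub>m n) = (- 2) \<cdot>\<^sub>m 1\<^sub>m n"
    by (auto simp: flip_mat_def)
  moreover have "vec_space.rank n ((- 2 :: real) \<cdot>\<^sub>m 1\<^sub>m n) = n"
    by (subst vec_space.det_rank_iff[symmetric]) auto
  ultimately have "n \<le> residual_rank n (flip_mat n S) + residual_rank n (flip_mat n ?T)"
    unfolding residual_rank_def
    using vec_space.rank_subadditive[of "flip_mat n S - 1\<^sub>m n" n n "flip_mat n ?T - 1\<^sub>m n"]
    by (simp add: minus_carrier_mat)
  moreover have "card S + card ?T = n"
    using S fin card_Un_disjoint[of S ?T] by (simp add: Un_absorb1)
  ultimately show ?thesis
    using residual_rank_flip_mat_le[OF fin, of n] residual_rank_flip_mat_le[of ?T n] by simp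
qed

section \<open>Isometries of hyperbolic space are linear\<close>

lemma minkowski_commute:
  "dim_vec x = dim_vec y \<Longrightarrow> minkowski x y = minkowski y x"
  by (simp add: minkowski_def mult.commute)

lemma minkowski_diff_smult:
  assumes "x \<in> carrier_vec (Suc n)" "y \<in> carrier_vec (Suc n)" "z \<in> carrier_vec (Suc n)"
  shows "minkowski (x - c \<cdot>\<^sub>v y) z = minkowski x z - c * minkowski y z"
  using assms
  by (simp add: minkowski_def algebra_simps sum.distrib sum_subtractf sum_distrib_left)

lemma minkowski_unit_vec:
  assumes "i \<le> n" "x \<in> carrier_vec (Suc n)"
  shows "minkowski (unit_vec (Suc n) i) x = (if i = 0 then - (x $ 0) else x $ i)"
proof -
  have "(\<Sum>j = 1..<Suc n. unit_vec (Suc n) i $ j * x $ j) = (\<Sum>j = 1..<Suc n. if j = i then x $ i else 0)"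
    using assms by (intro sum.cong) auto
  then show ?thesis
    using assms by (auto simp: minkowski_def)
qed

lemma hyperbolic_space_carrier: "x \<in> hyperbolic_space n \<Longrightarrow> x \<in> carrier_vec (Suc n)"
  by (simp add: hyperbolic_space_def)

text \<open>The reversed Cauchy-Schwarz inequality. It places \<open>- minkowski x y\<close> in \<open>[1, \<infinity>)\<close>, where
  \<open>arcosh\<close> is injective, so that the distance determines the form.\<close>

lemma minkowski_le_minus_1:
  assumes x: "x \<in> hyperbolic_space n" and y: "y \<in> hyperbolic_space n"
  shows "minkowski x y \<le> - 1"
proof -
  define s where "s = (\<Sum>i = 1..<Suc n. x $ i * y $ i)"
  have dims: "dim_vec x = Suc n" "dim_vec y = Suc n"
    and pos: "x $ 0 > 0" "y $ 0 > 0"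
    using x y by (auto simp: hyperbolic_space_def)
  have sx: "(\<Sum>i = 1..<Suc n. x $ i * x $ i) = x $ 0 * x $ 0 - 1"
    and sy: "(\<Sum>i = 1..<Suc n. y $ i * y $ i) = y $ 0 * y $ 0 - 1"
    using x y dims by (auto simp: hyperbolic_space_def minkowski_def)
  \<comment> \<open>With \<open>\<langle>x, x\<rangle> = \<langle>y, y\<rangle> = -1\<close>, this sum of squares is \<open>2 x\<^sub>0 y\<^sub>0 (x\<^sub>0 y\<^sub>0 - 1 - s)\<close>.\<close>
  have "0 \<le> (\<Sum>i = 1..<Suc n. (y $ 0 * x $ i - x $ 0 * y $ i)\<^sup>2) + (y $ 0 - x $ 0)\<^sup>2"
    by (intro add_nonneg_nonneg sum_nonneg) auto
  also have "(\<Sum>i = 1..<Suc n. (y $ 0 * x $ i - x $ 0 * y $ i)\<^sup>2)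
      = (\<Sum>i = 1..<Suc n. (y $ 0)\<^sup>2 * (x $ i * x $ i) + (x $ 0)\<^sup>2 * (y $ i * y $ i)
          - 2 * (x $ 0 * y $ 0) * (x $ i * y $ i))"
    by (intro sum.cong) (auto simp: power2_eq_square algebra_simps)
  also have "\<dots> = (y $ 0)\<^sup>2 * (x $ 0 * x $ 0 - 1) + (x $ 0)\<^sup>2 * (y $ 0 * y $ 0 - 1)
      - 2 * (x $ 0 * y $ 0) * s"
    unfolding sum_subtractf sum.distrib sum_distrib_left[symmetric] sx sy s_def ..
  also have "\<dots> + (y $ 0 - x $ 0)\<^sup>2 = 2 * (x $ 0 * y $ 0) * (x $ 0 * y $ 0 - 1 - s)"
    by (simp add: power2_eq_square algebra_simps)
  finally have "0 \<le> x $ 0 * y $ 0 - 1 - s"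
    using mult_pos_pos[OF pos] by (auto simp: zero_le_mult_iff)
  then show ?thesis
    using dims by (simp add: minkowski_def s_def)
qed

lemma isometry_in_hyperbolic_space: "f \<in> isometries n \<Longrightarrow> x \<in> hyperbolic_space n \<Longrightarrow> f x \<in> hyperbolic_space n"
  by (auto simp: isometries_def dest: Bij_imp_funcset)

lemma minkowski_isometry:
  assumes f: "f \<in> isometries n" and x: "x \<in> hyperbolic_space n" and y: "y \<in> hyperbolic_space n"
  shows "minkowski (f x) (f y) = minkowski x y"
proof -
  have "cosh (arcosh (- minkowski (f x) (f y))) = cosh (arcosh (- minkowski x y))"
    using f x y by (simp add: isometries_def hyperbolic_dist_def)
  then show ?thesis
    using minkowski_le_minus_1[OF x y]
      minkowski_le_minus_1[OF isometry_in_hyperbolic_space[OF f x] isometry_in_hyperbolic_space[OF f y]]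
    by simp
qed

text \<open>A basis of Minkowski space consisting of points of hyperbolic space. The coefficient \<open>\<surd>2\<close> of the
  time axis is forced by \<open>1 - c\<^sup>2 = -1\<close>.\<close>

definition frame_point :: "nat \<Rightarrow> nat \<Rightarrow> real vec" where
  "frame_point n i = (if i = 0 then unit_vec (Suc n) 0
     else unit_vec (Suc n) i + sqrt 2 \<cdot>\<^sub>v unit_vec (Suc n) 0)"

lemma frame_point_in_hyperbolic_space:
  assumes "i \<le> n"
  shows "frame_point n i \<in> hyperbolic_space n"
proof -
  have "minkowski (frame_point n i) (frame_point n i) = - 1"
  proof (cases "i = 0")
    case True
    then show ?thesis by (simp add: frame_point_def minkowski_unit_vec)
  next
    case False
    have "frame_point n i = unit_vec (Suc n) i - (- sqrt 2) \<cdot>\<^sub>v unit_vec (Suc n) 0"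
      using False by (auto simp: frame_point_def)
    then show ?thesis
      using False assms
      by (simp add: minkowski_diff_smult[of _ n] minkowski_unit_vec)
  qed
  then show ?thesis
    using assms by (auto simp: hyperbolic_space_def frame_point_def)
qed

lemma unit_vec_eq_frame_points:
  assumes "i \<le> n"
  shows "unit_vec (Suc n) i = frame_point n i - (if i = 0 then 0 else sqrt 2) \<cdot>\<^sub>v frame_point n 0"
  using assms by (auto simp: frame_point_def)

lemma mat_eq_on_hyperbolic_space:
  fixes A B :: "real mat"
  assumes A: "A \<in> carrier_mat (Suc n) (Suc n)" and B: "B \<in> carrier_mat (Suc n) (Suc n)"
    and eq: "\<And>x. x \<in> hyperbolic_space n \<Longrightarrow> A *\<^sub>v x = B *\<^sub>v x"
  shows "A = B"
proof -
  have "col A i = col B i" if i: "i \<le> n" for i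
  proof -
    note p = hyperbolic_space_carrier[OF frame_point_in_hyperbolic_space]
    have "A *\<^sub>v unit_vec (Suc n) i = B *\<^sub>v unit_vec (Suc n) i"
      unfolding unit_vec_eq_frame_points[OF i]
      using p[of i n] p[of 0 n] i A B
        eq[OF frame_point_in_hyperbolic_space[of i n]] eq[OF frame_point_in_hyperbolic_space[of 0 n]]
      by (simp add: mult_minus_distrib_mat_vec[of _ "Suc n" "Suc n"] mult_mat_vec[of _ "Suc n" "Suc n"])
    then show ?thesis
      using A B i by (auto simp: vec_eq_iff)
  qed
  then show ?thesis
    using A B by (intro mat_col_eqI) auto
qed

text \<open>The representing matrix of an isometry is unique, since hyperbolic space contains a basis.\<close>

definition represents :: "nat \<Rightarrow> real mat \<Rightarrow> (real vec \<Rightarrow> real vec) \<Rightarrow> bool" where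
  "represents n A f \<longleftrightarrow> A \<in> carrier_mat (Suc n) (Suc n) \<and> (\<forall>x \<in> hyperbolic_space n. f x = A *\<^sub>v x)"

lemma represents_unique: "represents n A f \<Longrightarrow> represents n B f \<Longrightarrow> A = B"
  using mat_eq_on_hyperbolic_space[of A n B] by (auto simp: represents_def)

text \<open>The images of the frame points determine candidates \<open>v i\<close> for the images of the unit vectors,
  and these again form a Lorentz frame. If \<open>A\<close> has them as columns and \<open>J\<close> is the Gram matrix of
  the form, then \<open>A\<^sup>T J A = J\<close>, so \<open>A\<close> is invertible. A point \<open>f x\<close> has the same products
  with the \<open>v i\<close> as \<open>x\<close> has with the unit vectors, that is, \<open>A\<^sup>T J (f x) = J x\<close>; cancelling
  gives \<open>f x = A x\<close>.\<close>

lemma isometry_represented: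
  assumes f: "f \<in> isometries n"
  obtains A where "represents n A f"
proof -
  let ?N = "Suc n"
  define c where "c i = (if i = 0 then 0 else sqrt 2)" for i :: nat
  define v where "v i = f (frame_point n i) - c i \<cdot>\<^sub>v f (frame_point n 0)" for i
  note p = frame_point_in_hyperbolic_space
  note fp = isometry_in_hyperbolic_space[OF f frame_point_in_hyperbolic_space]
  note car = hyperbolic_space_carrier
  have v_car: "v i \<in> carrier_vec ?N" if "i \<le> n" for i
    using that fp[of i] fp[of 0] by (auto simp: v_def hyperbolic_space_def)
  have v_image: "minkowski (v i) (f x) = minkowski (unit_vec ?N i) x"
    if "i \<le> n" "x \<in> hyperbolic_space n" for i x
    unfolding v_def unit_vec_eq_frame_points[OF that(1)] c_def[symmetric]
    using that p[of i n] p[of 0 n] fp[of i] fp[of 0] isometry_in_hyperbolic_space[OF f that(2)]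
    by (simp add: minkowski_diff_smult[OF car car car] minkowski_isometry[OF f])
  have v_v: "minkowski (v i) (v j) = minkowski (unit_vec ?N i) (unit_vec ?N j)"
    if "i \<le> n" "j \<le> n" for i j
  proof -
    have "minkowski (v i) (v j) = minkowski (v j) (v i)"
      using v_car[of i] v_car[of j] that by (simp add: minkowski_commute)
    also have "\<dots> = minkowski (f (frame_point n j)) (v i) - c j * minkowski (f (frame_point n 0)) (v i)"
      unfolding v_def[of j] using that fp[of j] fp[of 0] v_car[of i] car
      by (intro minkowski_diff_smult) auto
    also have "\<dots> = minkowski (v i) (f (frame_point n j)) - c j * minkowski (v i) (f (frame_point n 0))"
      using that fp[of j] fp[of 0] v_car[of i]
      by (simp add: hyperbolic_space_def minkowski_commute)
    also have "\<dots> = minkowski (unit_vec ?N i) (frame_point n j) - c j * minkowski (unit_vec ?N i) (frame_point n 0)"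
      using that p[of j n] p[of 0 n] by (simp add: v_image)
    also have "\<dots> = minkowski (frame_point n j) (unit_vec ?N i) - c j * minkowski (frame_point n 0) (unit_vec ?N i)"
      using that carrier_vecD[OF car[OF p[of j n]]] carrier_vecD[OF car[OF p[of 0 n]]]
      by (simp add: minkowski_commute[of "unit_vec ?N i"])
    also have "\<dots> = minkowski (unit_vec ?N j) (unit_vec ?N i)"
      unfolding unit_vec_eq_frame_points[OF that(2)] c_def[symmetric]
      using that p[of j n] p[of 0 n] car
      by (intro minkowski_diff_smult[symmetric]) auto
    also have "\<dots> = minkowski (unit_vec ?N i) (unit_vec ?N j)"
      by (intro minkowski_commute) auto
    finally show ?thesis .
  qed
  define J :: "real mat" where "J = mat ?N ?N (\<lambda>(i,j). if i = j then if i = 0 then - 1 else 1 else 0)"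
  have J: "J \<in> carrier_mat ?N ?N" by (simp add: J_def)
  have Jx: "J *\<^sub>v x = vec ?N (\<lambda>i. minkowski (unit_vec ?N i) x)" if "x \<in> carrier_vec ?N" for x
  proof (rule eq_vecI)
    fix i assume "i < dim_vec (vec ?N (\<lambda>i. minkowski (unit_vec ?N i) x))"
    then have i: "i < ?N" by simp
    have "(J *\<^sub>v x) $ i = (\<Sum>j = 0..<?N. (if i = j then if i = 0 then - 1 else 1 else 0) * x $ j)"
      using that i by (auto simp: J_def scalar_prod_def intro!: sum.cong)
    also have "\<dots> = (\<Sum>j = 0..<?N. if i = j then (if i = 0 then - 1 else 1) * x $ i else 0)"
      by (intro sum.cong) auto
    also have "\<dots> = minkowski (unit_vec ?N i) x"
      using i that by (simp add: minkowski_unit_vec)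
    finally show "(J *\<^sub>v x) $ i = vec ?N (\<lambda>i. minkowski (unit_vec ?N i) x) $ i"
      using i by simp
  qed (auto simp: J_def)
  have JJ: "J * J = 1\<^sub>m ?N"
  proof (rule eq_matI)
    fix i j assume "i < dim_row (1\<^sub>m ?N :: real mat)" "j < dim_col (1\<^sub>m ?N :: real mat)"
    then have ij: "i < ?N" "j < ?N" by auto
    then have "(J * J) $$ (i, j) = (J *\<^sub>v col J j) $ i"
      using J by simp
    also have "\<dots> = (1\<^sub>m ?N :: real mat) $$ (i, j)"
      using ij J by (subst Jx) (auto simp: minkowski_unit_vec J_def)
    finally show "(J * J) $$ (i, j) = (1\<^sub>m ?N :: real mat) $$ (i, j)" .
  qed (auto simp: J_def)
  have mink: "minkowski x y = x \<bullet> (J *\<^sub>v y)" if "x \<in> carrier_vec ?N" "y \<in> carrier_vec ?N" for x y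
  proof -
    have "x \<bullet> (J *\<^sub>v y) = (\<Sum>i = 0..<?N. x $ i * (if i = 0 then - (y $ 0) else y $ i))"
      using that by (simp add: Jx scalar_prod_def minkowski_unit_vec)
    also have "\<dots> = minkowski x y"
      using that by (simp add: minkowski_def sum.atLeast_Suc_lessThan)
    finally show ?thesis ..
  qed
  define A where "A = mat ?N ?N (\<lambda>(i, j). v j $ i)"
  have A: "A \<in> carrier_mat ?N ?N" by (simp add: A_def)
  have colA: "col A i = v i" if "i < ?N" for i
    using that v_car[of i] by (auto simp: A_def vec_eq_iff)
  have AJ: "(transpose_mat A * J) *\<^sub>v x = vec ?N (\<lambda>i. minkowski (v i) x)" if "x \<in> carrier_vec ?N" for x
    using A J that v_car
    by (auto simp: assoc_mult_mat_vec[of _ ?N ?N _ ?N] colA mink)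
  have entry: "(M * M') $$ (i, j) = (M *\<^sub>v col M' j) $ i" if "i < dim_row M" "j < dim_col M'"
    for M M' :: "real mat" and i j
    using that by simp
  have AJA: "transpose_mat A * J * A = J"
  proof (rule eq_matI)
    fix i j assume "i < dim_row J" "j < dim_col J"
    then have ij: "i < ?N" "j < ?N" using J by auto
    then have "(transpose_mat A * J * A) $$ (i, j) = ((transpose_mat A * J) *\<^sub>v col A j) $ i"
      using A J by (intro entry) auto
    also have "\<dots> = J $$ (i, j)"
      using ij v_car by (subst AJ) (auto simp: colA v_v minkowski_unit_vec J_def)
    finally show "(transpose_mat A * J * A) $$ (i, j) = J $$ (i, j)" .
  qed (use A J in auto)
  define B where "B = J * (transpose_mat A * J)"
  have B: "B \<in> carrier_mat ?N ?N" using A J by (simp add: B_def)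
  have "B * A = J * (transpose_mat A * J * A)"
    unfolding B_def using A J by (intro assoc_mult_mat[of _ ?N ?N _ ?N _ ?N]) auto
  then have "B * A = 1\<^sub>m ?N" by (simp add: AJA JJ)
  then have AB: "A * B = 1\<^sub>m ?N"
    using mat_mult_left_right_inverse[OF B A] by simp
  have "f x = A *\<^sub>v x" if x: "x \<in> hyperbolic_space n" for x
  proof -
    have fx: "f x \<in> carrier_vec ?N" and xc: "x \<in> carrier_vec ?N"
      using isometry_in_hyperbolic_space[OF f x] x car by auto
    have eq: "(transpose_mat A * J) *\<^sub>v f x = J *\<^sub>v x"
      using x by (auto simp: AJ[OF fx] Jx[OF xc] v_image)
    have "f x = (A * B) *\<^sub>v f x" using fx by (simp add: AB)
    also have "\<dots> = A *\<^sub>v (J *\<^sub>v ((transpose_mat A * J) *\<^sub>v f x))"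
      using A B J fx unfolding B_def
      by (simp add: assoc_mult_mat_vec[of _ ?N ?N _ ?N] del: assoc_mult_mat)
    also have "\<dots> = A *\<^sub>v ((J * J) *\<^sub>v x)"
      unfolding eq using J xc by (simp add: assoc_mult_mat_vec[of _ ?N ?N _ ?N])
    finally show ?thesis using xc by (simp add: JJ)
  qed
  then show ?thesis
    using that[of A] A by (simp add: represents_def)
qed

section \<open>Residual ranks of involutions\<close>

lemma carrier_Mob [simp]: "carrier (Mob n) = isometries n"
  by (simp add: Mob_def)

lemma mult_Mob_apply:
  assumes "f \<in> isometries n" "g \<in> isometries n" "x \<in> hyperbolic_space n"
  shows "(f \<otimes>\<^bsub>Mob n\<^esub> g) x = f (g x)"
  using assms by (simp add: Mob_def BijGroup_def isometries_def compose_eq)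

lemma one_Mob_apply: "x \<in> hyperbolic_space n \<Longrightarrow> \<one>\<^bsub>Mob n\<^esub> x = x"
  by (simp add: Mob_def BijGroup_def)

lemma represents_carrier: "represents n A f \<Longrightarrow> A \<in> carrier_mat (Suc n) (Suc n)"
  by (simp add: represents_def)

lemma represents_one: "represents n (1\<^sub>m (Suc n)) \<one>\<^bsub>Mob n\<^esub>"
  by (simp add: represents_def one_Mob_apply hyperbolic_space_def)

lemma represents_mult:
  assumes A: "represents n A f" and B: "represents n B g"
    and f: "f \<in> isometries n" and g: "g \<in> isometries n"
  shows "represents n (A * B) (f \<otimes>\<^bsub>Mob n\<^esub> g)"
  using A B isometry_in_hyperbolic_space[OF g] hyperbolic_space_carrier
  by (auto simp: represents_def mult_Mob_apply[OF f g] assoc_mult_mat_vec[of A "Suc n" "Suc n" B "Suc n"])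

text \<open>A linear subspace that meets hyperbolic space is spanned by the points in which it meets it, for
  being a multiple of a point of hyperbolic space is an open condition near \<open>p\<close>. Consequently
  the linear subspace cutting out a totally geodesic subspace is unique.\<close>

lemma subspace_subset_if_hyperbolic_points_subset:
  assumes U: "VectorSpace.subspace class_ring U (module_vec TYPE(real) (Suc n))"
    and W: "VectorSpace.subspace class_ring W (module_vec TYPE(real) (Suc n))"
    and p: "p \<in> hyperbolic_space n \<inter> U" and sub: "hyperbolic_space n \<inter> U \<subseteq> W"
  shows "U \<subseteq> W"
proof
  fix w assume w: "w \<in> U"
  let ?N = "Suc n"
  interpret U: LinearCombinations.submodule class_ring U "module_vec TYPE(real) ?N"
    using U by (simp add: VectorSpace.subspace_def)
  interpret W: LinearCombinations.submodule class_ring W "module_vec TYPE(real) ?N"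
    using W by (simp add: VectorSpace.subspace_def)
  have add: "x \<in> U \<Longrightarrow> y \<in> U \<Longrightarrow> x + y \<in> U" "x \<in> W \<Longrightarrow> y \<in> W \<Longrightarrow> x + y \<in> W" for x y
    using U.m_closed W.m_closed by (auto simp: module_vec_simps)
  have smult: "x \<in> U \<Longrightarrow> c \<cdot>\<^sub>v x \<in> U" "x \<in> W \<Longrightarrow> c \<cdot>\<^sub>v x \<in> W" for c x
    using U.smult_closed W.smult_closed by (auto simp: module_vec_simps class_ring_simps)
  have wc: "w \<in> carrier_vec ?N"
    using U.subset w by (auto simp: module_vec_simps)
  have pc: "p \<in> carrier_vec ?N" and pp: "minkowski p p = - 1" "p $ 0 > 0" and pU: "p \<in> U"
    using p by (auto simp: hyperbolic_space_def)
  have "((\<lambda>e. - 1 + 2 * e * minkowski p w + e\<^sup>2 * minkowski w w) \<longlongrightarrow>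
      - 1 + 2 * 0 * minkowski p w + 0\<^sup>2 * minkowski w w) (at_right 0)"
    by (intro tendsto_intros)
  then have "\<forall>\<^sub>F e in at_right 0. - 1 + 2 * e * minkowski p w + e\<^sup>2 * minkowski w w < 0"
    by (rule order_tendstoD) simp
  moreover have "((\<lambda>e. p $ 0 + e * w $ 0) \<longlongrightarrow> p $ 0 + 0 * w $ 0) (at_right 0)"
    by (intro tendsto_intros)
  then have "\<forall>\<^sub>F e in at_right 0. p $ 0 + e * w $ 0 > 0"
    by (rule order_tendstoD) (simp add: pp)
  moreover have "\<forall>\<^sub>F e in at_right 0. (0 :: real) < e"
    by (simp add: eventually_at_right_less)
  ultimately have "\<forall>\<^sub>F e in at_right 0. 0 < e \<and> p $ 0 + e * w $ 0 > 0 \<and>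
      - 1 + 2 * e * minkowski p w + e\<^sup>2 * minkowski w w < 0"
    by eventually_elim auto
  then obtain e where e: "0 < e" "p $ 0 + e * w $ 0 > 0"
    "- 1 + 2 * e * minkowski p w + e\<^sup>2 * minkowski w w < 0"
    using eventually_happens'[of "at_right (0::real)"] by auto
  \<comment> \<open>A vector near \<open>p\<close> that is still timelike and future-directed; it involves \<open>w\<close>.\<close>
  define q where "q = p + e \<cdot>\<^sub>v w"
  have qc: "q \<in> carrier_vec ?N" and qU: "q \<in> U"
    using pc wc pU w by (auto simp: q_def add smult)
  define r where "r = - minkowski q q"
  have "minkowski q q = - 1 + 2 * e * minkowski p w + e\<^sup>2 * minkowski w w"
    unfolding pp(1)[symmetric] using pc wc
    by (simp add: q_def minkowski_def algebra_simps sum.distrib sum_distrib_left power2_eq_square)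
  then have r: "r > 0" using e by (simp add: r_def)
  have "minkowski ((1 / sqrt r) \<cdot>\<^sub>v q) ((1 / sqrt r) \<cdot>\<^sub>v q) = (1 / sqrt r)\<^sup>2 * minkowski q q"
    using qc
    by (simp add: minkowski_def sum_divide_distrib diff_divide_distrib power2_eq_square
        del: sum.op_ivl_Suc)
  also have "\<dots> = - 1" using r by (simp add: r_def power_divide)
  finally have "(1 / sqrt r) \<cdot>\<^sub>v q \<in> hyperbolic_space n"
    using qc r e pc wc by (simp add: hyperbolic_space_def q_def)
  then have "(1 / sqrt r) \<cdot>\<^sub>v q \<in> W"
    using sub smult qU by auto
  then have "sqrt r \<cdot>\<^sub>v ((1 / sqrt r) \<cdot>\<^sub>v q) \<in> W" by (rule smult)
  then have qW: "q \<in> W" using r by (simp add: smult_smult_assoc)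
  have pW: "p \<in> W" using p sub by auto
  have "w = (1 / e) \<cdot>\<^sub>v (q + (- 1) \<cdot>\<^sub>v p)"
    using pc wc e by (auto simp: q_def algebra_simps)
  then show "w \<in> W"
    using add(2)[OF qW smult(2)[OF pW, of "- 1"]] smult(2) by metis
qed

lemma involution_matrix:
  assumes f: "f \<in> involutions (Mob n)" and A: "represents n A f"
  shows "A * A = 1\<^sub>m (Suc n)"
proof -
  interpret group "Mob n" by (rule group_Mob)
  have fi: "f \<in> isometries n" and "ord f = 2"
    using f by (auto simp: involutions_def)
  then have "f [^]\<^bsub>Mob n\<^esub> (2 :: nat) = \<one>\<^bsub>Mob n\<^esub>"
    using pow_ord_eq_1[of f] by simp
  then have "f \<otimes>\<^bsub>Mob n\<^esub> f = \<one>\<^bsub>Mob n\<^esub>"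
    using fi by (simp add: numeral_2_eq_2)
  then show ?thesis
    using represents_unique[OF represents_mult[OF A A fi fi]] represents_one[of n] by simp
qed

text \<open>The linear subspace \<open>W\<close> that cuts out the fixed point set has dimension \<open>n + 1 - k\<close> and must
  be the fixed space of \<open>A\<close>; rank-nullity does the rest.\<close>

lemma k_involution_residual_rank:
  assumes f: "f \<in> k_involutions n k" and A: "represents n A f"
  shows "residual_rank (Suc n) A = k"
proof -
  let ?V = "module_vec TYPE(real) (Suc n)" and ?K = "mat_kernel (A - 1\<^sub>m (Suc n))"
  have Ac: "A \<in> carrier_mat (Suc n) (Suc n)" using A by (rule represents_carrier)
  then have Kc: "A - 1\<^sub>m (Suc n) \<in> carrier_mat (Suc n) (Suc n)" by auto
  obtain m W where mk: "m + k = n" and W: "VectorSpace.subspace class_ring W ?V"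
    and dim: "vectorspace.dim class_ring (?V\<lparr>carrier := W\<rparr>) = Suc m"
    and fix_W: "{x \<in> hyperbolic_space n. f x = x} = hyperbolic_space n \<inter> W"
    and ne: "{x \<in> hyperbolic_space n. f x = x} \<noteq> {}"
    using f by (auto simp: k_involutions_def totally_geodesic_def)
  have "f x = x \<longleftrightarrow> x \<in> ?K" if x: "x \<in> hyperbolic_space n" for x
  proof -
    have "(A - 1\<^sub>m (Suc n)) *\<^sub>v x = A *\<^sub>v x - x"
      using Ac hyperbolic_space_carrier[OF x] by (simp add: minus_mult_distrib_mat_vec[of _ "Suc n" "Suc n"])
    then show ?thesis
      using A x Ac hyperbolic_space_carrier[OF x]
      by (auto simp: mat_kernel_def represents_def vec_eq_iff)
  qed
  then have fix_K: "{x \<in> hyperbolic_space n. f x = x} = hyperbolic_space n \<inter> ?K"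
    by auto
  have K: "VectorSpace.subspace class_ring ?K ?V"
    by (rule vec_space.mat_kernel_subspace[OF Kc])
  obtain p where "p \<in> hyperbolic_space n \<inter> W" "p \<in> hyperbolic_space n \<inter> ?K"
    using ne fix_W fix_K by auto
  then have "W = ?K"
    using subspace_subset_if_hyperbolic_points_subset[OF W K, of p]
      subspace_subset_if_hyperbolic_points_subset[OF K W, of p] fix_W fix_K
    by auto
  then show ?thesis
    using vec_space.rank_plus_dim_kernel[OF Kc] dim mk by (simp add: residual_rank_def)
qed

lemma conjugacy_class_residual_rank:
  assumes eq: "conjugacy_class (Mob n) f = conjugacy_class (Mob n) g"
    and f: "f \<in> isometries n" and g: "g \<in> isometries n"
    and A: "represents n A f" and B: "represents n B g"
  shows "residual_rank (Suc n) B \<le> residual_rank (Suc n) A"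
proof -
  interpret group "Mob n" by (rule group_Mob)
  have "f \<in> conjugacy_class (Mob n) f"
    using f one_closed by (auto simp: conjugacy_class_def intro!: exI[of _ "\<one>\<^bsub>Mob n\<^esub>"])
  then obtain u where u: "u \<in> isometries n" and f_eq: "f = u \<otimes>\<^bsub>Mob n\<^esub> g \<otimes>\<^bsub>Mob n\<^esub> inv\<^bsub>Mob n\<^esub> u"
    unfolding eq by (auto simp: conjugacy_class_def)
  have u': "inv\<^bsub>Mob n\<^esub> u \<in> isometries n" using inv_closed[of u] u by simp
  have fu: "f \<otimes>\<^bsub>Mob n\<^esub> u = u \<otimes>\<^bsub>Mob n\<^esub> g"
    unfolding f_eq using u g unfolding carrier_Mob[symmetric]
    by (simp add: m_assoc del: carrier_Mob)
  obtain U where U: "represents n U u" using isometry_represented[OF u] .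
  obtain U' where U': "represents n U' (inv\<^bsub>Mob n\<^esub> u)" using isometry_represented[OF u'] .
  have "represents n (U' * U) \<one>\<^bsub>Mob n\<^esub>"
    using represents_mult[OF U' U u' u] u by simp
  then have "U' * U = 1\<^sub>m (Suc n)"
    using represents_one by (rule represents_unique)
  moreover have "A * U = U * B"
    using represents_mult[OF A U f u] represents_mult[OF U B u g] unfolding fu
    by (rule represents_unique)
  ultimately show ?thesis
    using A B U U' by (intro residual_rank_conjugate_le) (auto dest: represents_carrier)
qed

section \<open>Coordinate flips and conjugacy classes\<close>

definition coordinate_flip :: "nat \<Rightarrow> nat set \<Rightarrow> real vec \<Rightarrow> real vec" where
  "coordinate_flip n S = (\<lambda>x \<in> hyperbolic_space n. flip_mat (Suc n) S *\<^sub>v x)"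

lemma flip_mat_mult_vec:
  assumes "x \<in> carrier_vec n"
  shows "flip_mat n S *\<^sub>v x = vec n (\<lambda>i. (if i \<in> S then - 1 else 1) * x $ i)"
proof (rule eq_vecI)
  fix i assume "i < dim_vec (vec n (\<lambda>i. (if i \<in> S then - 1 else 1) * x $ i))"
  then have i: "i < n" by simp
  have "(flip_mat n S *\<^sub>v x) $ i = (\<Sum>j = 0..<n. flip_mat n S $$ (i, j) * x $ j)"
    using assms i by (auto simp: flip_mat_def scalar_prod_def intro!: sum.cong)
  also have "\<dots> = (\<Sum>j = 0..<n. if i = j then (if i \<in> S then - 1 else 1) * x $ i else 0)"
    using i by (intro sum.cong) (auto simp: flip_mat_def)
  finally show "(flip_mat n S *\<^sub>v x) $ i = vec n (\<lambda>i. (if i \<in> S then - 1 else 1) * x $ i) $ i"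
    using i by simp
qed (simp add: flip_mat_def)

lemma minkowski_flip_mat:
  assumes "x \<in> carrier_vec (Suc n)" "y \<in> carrier_vec (Suc n)"
  shows "minkowski (flip_mat (Suc n) S *\<^sub>v x) (flip_mat (Suc n) S *\<^sub>v y) = minkowski x y"
  using assms
  by (auto simp: flip_mat_mult_vec minkowski_def simp del: sum.op_ivl_Suc intro!: sum.cong)

lemma flip_mat_flip_mat:
  "x \<in> carrier_vec n \<Longrightarrow> flip_mat n S *\<^sub>v (flip_mat n S *\<^sub>v x) = x"
  by (auto simp: flip_mat_mult_vec)

lemma flip_mat_in_hyperbolic_space:
  assumes "x \<in> hyperbolic_space n" "0 \<notin> S"
  shows "flip_mat (Suc n) S *\<^sub>v x \<in> hyperbolic_space n"
  using assms minkowski_flip_mat[of x n x S]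
  by (auto simp: hyperbolic_space_def flip_mat_mult_vec)

lemma represents_coordinate_flip: "represents n (flip_mat (Suc n) S) (coordinate_flip n S)"
  by (simp add: represents_def coordinate_flip_def)

lemma coordinate_flip_isometry:
  assumes S: "0 \<notin> S"
  shows "coordinate_flip n S \<in> isometries n"
proof -
  have "bij_betw (coordinate_flip n S) (hyperbolic_space n) (hyperbolic_space n)"
    by (rule bij_betwI[where g = "coordinate_flip n S"])
      (auto simp: coordinate_flip_def flip_mat_in_hyperbolic_space[OF _ S] flip_mat_flip_mat hyperbolic_space_carrier)
  then show ?thesis
    by (auto simp: isometries_def Bij_def coordinate_flip_def hyperbolic_dist_def minkowski_flip_mat
        hyperbolic_space_carrier)
qed

lemma coordinate_flip_involution:
  assumes S: "S \<subseteq> {1..n}" "S \<noteq> {}"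
  shows "coordinate_flip n S \<in> involutions (Mob n)"
proof -
  interpret group "Mob n" by (rule group_Mob)
  have "0 \<notin> S" using S(1) by auto
  note S = S this
  have f: "coordinate_flip n S \<in> isometries n" using S(3) by (rule coordinate_flip_isometry)
  have "coordinate_flip n S \<otimes>\<^bsub>Mob n\<^esub> coordinate_flip n S = \<one>\<^bsub>Mob n\<^esub>"
  proof -
    have "compose (hyperbolic_space n) (coordinate_flip n S) (coordinate_flip n S) = (\<lambda>x \<in> hyperbolic_space n. x)"
      unfolding compose_def
      by (intro restrict_ext)
        (simp add: coordinate_flip_def flip_mat_in_hyperbolic_space[OF _ S(3)] flip_mat_flip_mat hyperbolic_space_carrier)
    then show ?thesis
      using f by (simp add: Mob_def BijGroup_def isometries_def)
  qed
  then have "coordinate_flip n S [^]\<^bsub>Mob n\<^esub> (2 :: nat) = \<one>\<^bsub>Mob n\<^esub>"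
    using f by (simp add: numeral_2_eq_2)
  then have "ord (coordinate_flip n S) dvd 2"
    using f pow_eq_id by simp
  moreover have "coordinate_flip n S \<noteq> \<one>\<^bsub>Mob n\<^esub>"
  proof
    assume "coordinate_flip n S = \<one>\<^bsub>Mob n\<^esub>"
    then have "flip_mat (Suc n) S = 1\<^sub>m (Suc n)"
      using represents_unique[OF represents_coordinate_flip] represents_one by metis
    then have "card S = 0"
      using residual_rank_flip_mat[of S "Suc n"] S(1) by (force simp: residual_rank_one)
    then show False using S finite_subset by fastforce
  qed
  then have "ord (coordinate_flip n S) \<noteq> 1"
    using f ord_eq_1 by simp
  ultimately have "ord (coordinate_flip n S) = 2"
    using prime_nat_iff two_is_prime_nat by metis
  then show ?thesis using f by (simp add: involutions_def)
qed

lemma det_flip_mat: "det (flip_mat n S) = (- 1) ^ card ({..<n} \<inter> S)"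
proof -
  have "det (flip_mat n S) = prod_list (diag_mat (flip_mat n S))"
    by (rule det_upper_triangular[where n = n]) (auto simp: flip_mat_def)
  also have "diag_mat (flip_mat n S) = map (\<lambda>i. if i \<in> S then - 1 else 1) [0..<n]"
    by (auto simp: diag_mat_def flip_mat_def)
  also have "prod_list \<dots> = (\<Prod>i\<in>{..<n}. if i \<in> S then - 1 else 1)"
    by (simp add: prod.list_conv_set_nth atLeast0LessThan)
  finally show ?thesis
    by (simp add: prod.If_cases)
qed

lemma coordinate_flip_Mob_plus:
  assumes S: "S \<subseteq> {1..n}" "even (card S)"
  shows "coordinate_flip n S \<in> Mob_plus n"
proof -
  have "{..<Suc n} \<inter> S = S" using S(1) by auto
  then have "det (flip_mat (Suc n) S) > 0"
    using S(2) by (simp add: det_flip_mat)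
  moreover have "coordinate_flip n S \<in> isometries n" using S(1) by (intro coordinate_flip_isometry) auto
  ultimately show ?thesis
    using represents_coordinate_flip[of n S] by (auto simp: Mob_plus_def represents_def)
qed

lemma card_conjugacy_classes_ge:
  assumes fin: "finite (conjugacy_class (Mob n) ` involutions (Mob n))"
  shows "n \<le> card (conjugacy_class (Mob n) ` involutions (Mob n))"
proof -
  let ?c = "\<lambda>k. conjugacy_class (Mob n) (coordinate_flip n {1..k})"
  have le: "j \<le> k" if "?c k = ?c j" "j \<in> {1..n}" "k \<in> {1..n}" for j k
  proof -
    have "residual_rank (Suc n) (flip_mat (Suc n) {1..j}) \<le> residual_rank (Suc n) (flip_mat (Suc n) {1..k})"
      by (rule conjugacy_class_residual_rank[OF that(1)])
        (auto intro: coordinate_flip_isometry represents_coordinate_flip)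
    moreover have "{1..j} \<subseteq> {..<Suc n}" "{1..k} \<subseteq> {..<Suc n}"
      using that(2, 3) by auto
    ultimately show ?thesis
      by (simp add: residual_rank_flip_mat)
  qed
  have "inj_on ?c {1..n}"
    by (intro inj_onI antisym) (auto intro: le)
  moreover have "?c ` {1..n} \<subseteq> conjugacy_class (Mob n) ` involutions (Mob n)"
    by (auto intro!: imageI coordinate_flip_involution)
  ultimately have "card {1..n} \<le> card (conjugacy_class (Mob n) ` involutions (Mob n))"
    using fin by (rule card_inj_on_le)
  then show ?thesis by simp
qed

section \<open>Codimensions for which the length is two\<close>

text \<open>An infimum of extended natural numbers that is finite is attained.\<close>

lemma short_word:
  assumes len: "length_wrt G S A \<le> enat l" and g: "g \<in> A"
  obtains ws where "ws \<in> lists S" "foldr (mult G) ws \<one>\<^bsub>G\<^esub> = g" "length ws \<le> l"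
proof -
  have "word_length G S g \<le> length_wrt G S A"
    unfolding length_wrt_def using g by (rule SUP_upper)
  then have "word_length G S g < enat (Suc l)"
    using len by (metis enat_ord_simps(2) lessI order.strict_trans1 order.trans)
  then show ?thesis
    using that unfolding word_length_def Inf_less_iff
    by (auto simp: less_Suc_eq_le)
qed

text \<open>The test element is the flip of all spatial coordinates, or of all but the first, so that an even
  number of signs makes it orientation preserving.\<close>

lemma codimension_of_length_two:
  assumes n: "n \<ge> 2" and len: "length_wrt (Mob n) (k_involutions n k) (Mob_plus n) = 2"
  shows "k \<in> {n - 1, n} \<or> (n - 1 \<le> 2 * k \<and> 2 * k \<le> n + 3)"
proof -
  interpret group "Mob n" by (rule group_Mob)
  define S where "S = (if even n then {1..n} else {2..n})"
  have S: "S \<subseteq> {1..n}" "even (card S)" and cS: "n \<le> card S + 1" "card S \<le> n"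
    using n by (auto simp: S_def)
  let ?g = "coordinate_flip n S" and ?G = "flip_mat (Suc n) S"
  have "S \<subseteq> {..<Suc n}" using S(1) by auto
  then have rG: "residual_rank (Suc n) ?G = card S" by (rule residual_rank_flip_mat)
  obtain ws where ws: "ws \<in> lists (k_involutions n k)"
    "foldr (mult (Mob n)) ws \<one>\<^bsub>Mob n\<^esub> = ?g" "length ws \<le> 2"
    using short_word[of "Mob n" _ _ 2, OF _ coordinate_flip_Mob_plus[OF S]] len by (metis numeral_eq_enat order_refl)
  have inv: "f \<in> involutions (Mob n)" "f \<in> isometries n" if "f \<in> k_involutions n k" for f
    using that by (auto simp: k_involutions_def involutions_def)
  consider "ws = []" | a where "ws = [a]" | a b where "ws = [a, b]"
    using ws(3) by (cases ws; cases "tl ws") auto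
  then show ?thesis
  proof cases
    case 1
    then have "?G = 1\<^sub>m (Suc n)"
      using ws(2) represents_unique[OF represents_coordinate_flip] represents_one by (metis foldr.simps(1) id_apply)
    then have "residual_rank (Suc n) ?G = 0"
      by (simp add: residual_rank_one)
    then show ?thesis using rG cS n by simp
  next
    case 2
    then have "?g \<in> k_involutions n k"
      using ws inv(2)[of a] by simp
    then show ?thesis
      using k_involution_residual_rank[OF _ represents_coordinate_flip] rG cS n by force
  next
    case 3
    then have a: "a \<in> k_involutions n k" and b: "b \<in> k_involutions n k" and g: "a \<otimes>\<^bsub>Mob n\<^esub> b = ?g"
      using ws inv(2) by auto
    obtain A where A: "represents n A a" using isometry_represented[OF inv(2)[OF a]] .
    obtain B where B: "represents n B b" using isometry_represented[OF inv(2)[OF b]] .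
    note car = represents_carrier[OF A] represents_carrier[OF B]
    note sq = involution_matrix[OF inv(1)[OF a] A] involution_matrix[OF inv(1)[OF b] B]
    have "?G = A * B"
      using represents_mult[OF A B inv(2)[OF a] inv(2)[OF b]] unfolding g
      by (rule represents_unique[OF represents_coordinate_flip])
    then have "card S \<le> 2 * k" "card S + 2 * k \<le> 2 * n + 2"
      using residual_rank_mult_le[OF car] residual_rank_mult_involutions_le[OF car(1) sq(1) car(2) sq(2)]
        k_involution_residual_rank[OF a A] k_involution_residual_rank[OF b B] rG
      by simp_all
    then have "n - 1 \<le> 2 * k" "2 * k \<le> n + 3" using cS(1) by linarith+
    then show ?thesis by blast
  qed
qed

lemma Phi_le:
  assumes n: "n \<ge> 2"
  shows "0 \<le> Phi n" "Phi n \<le> 5 / real n"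
proof -
  let ?K = "{k \<in> {1..n}. length_wrt (Mob n) (k_involutions n k) (Mob_plus n) = 2}"
  let ?C = "conjugacy_class (Mob n) ` involutions (Mob n)"
  \<comment> \<open>An interval \<open>n - 1 \<le> 2 k \<le> n + 3\<close> of length four contains at most three even numbers.\<close>
  have "?K \<subseteq> {n - 1, n} \<union> (\<lambda>i. (n - 1) div 2 + i) ` {0, 1, 2}"
  proof
    fix k assume "k \<in> ?K"
    then have "k \<in> {n - 1, n} \<or> (n - 1 \<le> 2 * k \<and> 2 * k \<le> n + 3)"
      using codimension_of_length_two[OF n] by simp
    then show "k \<in> {n - 1, n} \<union> (\<lambda>i. (n - 1) div 2 + i) ` {0, 1, 2}"
      by simp presburger
  qed
  then have "card ?K \<le> card ({n - 1, n} \<union> (\<lambda>i. (n - 1) div 2 + i) ` {0, 1, 2})"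
    by (rule card_mono[rotated]) simp
  also have "\<dots> \<le> 5"
    by (simp add: card_insert_if)
  finally have K: "real (card ?K) \<le> 5" by simp
  show "0 \<le> Phi n" by (simp add: Phi_def)
  show "Phi n \<le> 5 / real n"
  proof (cases "finite ?C")
    case True
    then show ?thesis
      using K card_conjugacy_classes_ge[OF True] n unfolding Phi_def
      by (intro frac_le) auto
  next
    \<comment> \<open>If there were infinitely many classes, the denominator would be \<open>0\<close> by convention, and so
      would be the quotient.\<close>
    case False
    then show ?thesis by (simp add: Phi_def)
  qed
qed

theorem corollary1p3:
  shows "Phi \<in> O(\<lambda>n. real n powr (- 1 / 2))"
proof (rule landau_o.bigI)
  show "\<forall>\<^sub>F n in at_top. norm (Phi n) \<le> 5 * norm (real n powr (- 1 / 2))"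
    using eventually_ge_at_top[of 2]
  proof eventually_elim
    case (elim n)
    have "Phi n \<le> 5 * real n powr (- 1)"
      using Phi_le(2)[OF elim] elim by (simp add: powr_minus_divide)
    also have "\<dots> \<le> 5 * real n powr (- 1 / 2)"
      using elim by (intro mult_left_mono powr_mono) auto
    finally show ?case
      using Phi_le(1)[OF elim] by simp
  qed
qed simp

end
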